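(* Let $\mathfrak g$ be an $8$-dimensional real nilpotent Lie algebra with a 1-abelian complex structure $J=J_M$, where $M\in M_3(\mathbb C)$ is a Hermitian matrix of rank $3-r$. Then there exists a basis $\{\sigma^i\}_{i=1}^4$ of $\mathfrak g^{1,0}$ such that $d\sigma^1=d\sigma^2=d\sigma^3=0$ and the complex structure equations $J_{4,k,r}$ are given by one of: $J_{4,3,0}$: $d\sigma^4=\sigma^{1\bar 1}+\sigma^{2\bar 2}+\sigma^{3\bar 3}$; $J_{4,2,0}$: $d\sigma^4=\sigma^{1\bar 1}+\sigma^{2\bar 2}-\sigma^{3\bar 3}$; $J_{4,2,1}$: $d\sigma^4=\sigma^{1\bar 1}+\sigma^{2\bar 2}$; $J_{4,1,1}$: $d\sigma^4=\sigma^{1\bar 1}-\sigma^{2\bar 2}$; $J_{4,1,2}$: $d\sigma^4=\sigma^{1\bar 1}$.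
   Context: For a complex structure $J$ on a real Lie algebra $\mathfrak g$, $\mathfrak g^{1,0}\subset\mathfrak g^*_{\mathbb C}$ is the space of $(1,0)$-forms and $d$ is the Chevalley–Eilenberg differential. We write $\sigma^{j\bar k}=\sigma^j\wedge\overline{\sigma^k}$. $J$ is abelian if $[Jx,Jy]=[x,y]$ for all $x,y$. An abelian complex structure on a $2n$-dimensional nilpotent Lie algebra is 1-abelian if $h^{1,0}=\dim\ker(\bar\partial:\mathfrak g^{1,0}\to\bigwedge^{1,1}\mathfrak g^* )$ equals $n-1$. For every 1-abelian complex structure there are a basis $\{\omega^i\}_{i=1}^n$ of $\mathfrak g^{1,0}$ and a nonzero $M\in M_{n-1}(\mathbb C)$ with $d\omega^1=\dots=d\omega^{n-1}=0$ and $d\omega^n=\sum_{j,k=1}^{n-1}M_{jk}\,\omega^{j\bar k}$; the structure is then denoted $J_M$. In the notation $J_{4,k,r}$ the index $r$ is the dimension of $\ker M$. *)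

theory Defs
  imports "HOL-Analysis.Analysis" "HOL-Library.Function_Algebras"
begin

section \<open>Real Lie algebras\<close>

definition lie_bracket :: "('a::real_vector \<Rightarrow> 'a \<Rightarrow> 'a) \<Rightarrow> bool" where
  "lie_bracket br \<longleftrightarrow>
     bilinear br \<and>
     (\<forall>x. br x x = 0) \<and>
     (\<forall>x y z. br x (br y z) + br y (br z x) + br z (br x y) = 0)"

primrec lower_central :: "('a::real_vector \<Rightarrow> 'a \<Rightarrow> 'a) \<Rightarrow> nat \<Rightarrow> 'a set" where
  "lower_central br 0 = UNIV"
| "lower_central br (Suc k) = span {br x y | x y. y \<in> lower_central br k}"

definition nilpotent_lie :: "('a::real_vector \<Rightarrow> 'a \<Rightarrow> 'a) \<Rightarrow> bool" where
  "nilpotent_lie br \<longleftrightarrow> (\<exists>k. lower_central br k = {0})"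

definition complex_structure :: "('a::real_vector \<Rightarrow> 'a \<Rightarrow> 'a) \<Rightarrow> ('a \<Rightarrow> 'a) \<Rightarrow> bool" where
  "complex_structure br J \<longleftrightarrow>
     linear J \<and>
     (\<forall>x. J (J x) = - x) \<and>
     (\<forall>x y. br (J x) (J y) - J (br (J x) y) - J (br x (J y)) - br x y = 0)"

definition abelian_complex_structure ::
    "('a::real_vector \<Rightarrow> 'a \<Rightarrow> 'a) \<Rightarrow> ('a \<Rightarrow> 'a) \<Rightarrow> bool" where
  "abelian_complex_structure br J \<longleftrightarrow>
     complex_structure br J \<and> (\<forall>x y. br (J x) (J y) = br x y)"


section \<open>Complex-valued forms\<close>

text \<open>
  An element of the complexified dual is a real-linear map from the Lie algebra to the complex
  numbers, which is the same as a complex-linear functional on the complexified Lie algebra.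
  Likewise a complex 2-form is an alternating real-bilinear complex-valued map.
  Forms are added pointwise; the complex scalar multiplication of 1-forms is the following.
\<close>

definition form_scale :: "complex \<Rightarrow> ('a \<Rightarrow> complex) \<Rightarrow> 'a \<Rightarrow> complex" where
  "form_scale c \<alpha> = (\<lambda>x. c * \<alpha> x)"

global_interpretation form: vector_space "form_scale :: complex \<Rightarrow> ('a \<Rightarrow> complex) \<Rightarrow> 'a \<Rightarrow> complex"
  by unfold_locales (simp_all add: form_scale_def fun_eq_iff algebra_simps)

definition wedge :: "('a \<Rightarrow> complex) \<Rightarrow> ('a \<Rightarrow> complex) \<Rightarrow> 'a \<Rightarrow> 'a \<Rightarrow> complex" where
  "wedge \<alpha> \<beta> = (\<lambda>x y. \<alpha> x * \<beta> y - \<alpha> y * \<beta> x)"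

definition conj_form :: "('a \<Rightarrow> complex) \<Rightarrow> 'a \<Rightarrow> complex" where
  "conj_form \<alpha> = (\<lambda>x. cnj (\<alpha> x))"

definition wedge_conj :: "(nat \<Rightarrow> 'a \<Rightarrow> complex) \<Rightarrow> nat \<Rightarrow> nat \<Rightarrow> 'a \<Rightarrow> 'a \<Rightarrow> complex" where
  "wedge_conj \<sigma> j k = wedge (\<sigma> j) (conj_form (\<sigma> k))"

text \<open>The Chevalley--Eilenberg differential on 1-forms.\<close>

definition ce_d :: "('a \<Rightarrow> 'a \<Rightarrow> 'a) \<Rightarrow> ('a \<Rightarrow> complex) \<Rightarrow> 'a \<Rightarrow> 'a \<Rightarrow> complex" where
  "ce_d br \<alpha> = (\<lambda>x y. - \<alpha> (br x y))"

definition forms10 :: "('a::real_vector \<Rightarrow> 'a) \<Rightarrow> ('a \<Rightarrow> complex) set" where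
  "forms10 J = {\<alpha>. linear \<alpha> \<and> (\<forall>x. \<alpha> (J x) = \<i> * \<alpha> x)}"

text \<open>
  The (1,1)-component of a 2-form: substituting \<open>J\<close> in both arguments fixes (1,1)-forms and
  changes the sign of (2,0)- and (0,2)-forms; see the lemmas \<open>proj11_20\<close>, \<open>proj11_11\<close>, \<open>proj11_02\<close>.
\<close>

definition proj11 :: "('a \<Rightarrow> 'a) \<Rightarrow> ('a \<Rightarrow> 'a \<Rightarrow> complex) \<Rightarrow> 'a \<Rightarrow> 'a \<Rightarrow> complex" where
  "proj11 J \<beta> = (\<lambda>x y. (\<beta> x y + \<beta> (J x) (J y)) / 2)"

lemma i_times_i: "\<i> * a * (\<i> * b) = - (a * b)"
  by (simp add: complex_eq_iff)

lemma proj11_20: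
  "\<alpha> \<in> forms10 J \<Longrightarrow> \<beta> \<in> forms10 J \<Longrightarrow> proj11 J (wedge \<alpha> \<beta>) = 0"
  by (simp add: proj11_def wedge_def forms10_def fun_eq_iff i_times_i)

lemma proj11_11:
  "\<alpha> \<in> forms10 J \<Longrightarrow> \<beta> \<in> forms10 J \<Longrightarrow>
     proj11 J (wedge \<alpha> (conj_form \<beta>)) = wedge \<alpha> (conj_form \<beta>)"
  by (simp add: proj11_def wedge_def conj_form_def forms10_def fun_eq_iff i_times_i)

lemma proj11_02:
  "\<alpha> \<in> forms10 J \<Longrightarrow> \<beta> \<in> forms10 J \<Longrightarrow> proj11 J (wedge (conj_form \<alpha>) (conj_form \<beta>)) = 0"
  by (simp add: proj11_def wedge_def conj_form_def forms10_def fun_eq_iff i_times_i)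

definition dbar ::
    "('a \<Rightarrow> 'a \<Rightarrow> 'a) \<Rightarrow> ('a \<Rightarrow> 'a) \<Rightarrow> ('a \<Rightarrow> complex) \<Rightarrow> 'a \<Rightarrow> 'a \<Rightarrow> complex" where
  "dbar br J \<alpha> = proj11 J (ce_d br \<alpha>)"

definition h10 :: "('a::real_vector \<Rightarrow> 'a \<Rightarrow> 'a) \<Rightarrow> ('a \<Rightarrow> 'a) \<Rightarrow> nat" where
  "h10 br J = form.dim {\<alpha> \<in> forms10 J. dbar br J \<alpha> = 0}"

definition basis10 :: "('a::real_vector \<Rightarrow> 'a) \<Rightarrow> nat \<Rightarrow> (nat \<Rightarrow> 'a \<Rightarrow> complex) \<Rightarrow> bool" where
  "basis10 J n \<sigma> \<longleftrightarrow>
     inj_on \<sigma> {1..n} \<and> form.independent (\<sigma> ` {1..n}) \<and> form.span (\<sigma> ` {1..n}) = forms10 J"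


section \<open>1-abelian complex structures\<close>

text \<open>The last equation says \<open>h10 = n - 1\<close> without truncated subtraction.\<close>

definition one_abelian :: "('a::real_vector \<Rightarrow> 'a \<Rightarrow> 'a) \<Rightarrow> ('a \<Rightarrow> 'a) \<Rightarrow> bool" where
  "one_abelian br J \<longleftrightarrow>
     nilpotent_lie br \<and> abelian_complex_structure br J \<and>
     (\<exists>n. dim (UNIV :: 'a set) = 2 * n \<and> h10 br J + 1 = n)"

text \<open>
  The equations of \<open>J\<^sub>M\<close> in complex dimension four. The rows and columns of \<open>M\<close> are indexed by
  the three-element type \<open>3\<close>, in which \<open>of_nat\<close> maps \<open>1, 2, 3\<close> to the three distinct
  indices \<open>1, 2, 3\<close> (and \<open>3 = 0\<close>).
\<close>

definition JM_basis ::
    "('a::real_vector \<Rightarrow> 'a \<Rightarrow> 'a) \<Rightarrow> ('a \<Rightarrow> 'a) \<Rightarrow> (nat \<Rightarrow> 'a \<Rightarrow> complex) \<Rightarrow> complex^3^3 \<Rightarrow> bool" where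
  "JM_basis br J \<omega> M \<longleftrightarrow>
     basis10 J 4 \<omega> \<and> M \<noteq> 0 \<and>
     (\<forall>i\<in>{1..3}. ce_d br (\<omega> i) = 0) \<and>
     ce_d br (\<omega> 4) =
       (\<lambda>x y. \<Sum>j\<in>{1..3}. \<Sum>k\<in>{1..3}. M $ of_nat j $ of_nat k * wedge_conj \<omega> j k x y)"

definition hermitian :: "complex^'n^'n \<Rightarrow> bool" where
  "hermitian M \<longleftrightarrow> (\<forall>i j. M $ i $ j = cnj (M $ j $ i))"

end

theory Submission
  imports Defs
begin

text \<open>
  The theorem is Sylvester's reduction of a Hermitian form, carried out in the closed forms
  \<open>\<omega>\<^sup>1, \<omega>\<^sup>2, \<omega>\<^sup>3\<close>. Collect their values at \<open>x\<close> into a vector \<open>X(x)\<close> of three complex numbers. Writing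
  \<open>H\<close> for the sesquilinear form with matrix \<open>M\<close>, the structure equation of \<open>\<omega>\<^sup>4\<close> becomes
  \<open>d\<omega>\<^sup>4(x, y) = H(X(x), X(y)) - H(X(y), X(x))\<close>. So if \<open>H\<close> is diagonal in the coordinates
  \<open>\<sigma>\<^sup>i = \<Sum>j. A\<^sub>i\<^sub>j \<omega>\<^sup>j\<close>, then \<open>d\<omega>\<^sup>4\<close> is the corresponding diagonal combination of the forms
  \<open>\<sigma>\<^sup>i \<and> cnj \<sigma>\<^sup>i\<close>, and the \<open>\<sigma>\<^sup>i\<close> are closed because they are combinations of closed forms
  with constant coefficients.

  A Hermitian form has an orthogonal basis whose vectors \<open>b\<close> all have \<open>H(b, b)\<close> in \<open>{1, -1, 0}\<close>
  (\<open>hermitian_orthogonal_basis\<close>). The number of nonzero values is the rank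
  (\<open>rank_eq_card_nonisotropic\<close>). A change of sign of \<open>\<omega>\<^sup>4\<close> exchanges the two signs, so that at
  least as many values can be taken to be \<open>1\<close> as \<open>-1\<close>; not all are \<open>0\<close> because \<open>M \<noteq> 0\<close>.
  The signatures \<open>(p, q)\<close> with \<open>q \<le> p\<close> and \<open>1 \<le> p + q \<le> 3\<close> are \<open>(3,0)\<close>, \<open>(2,1)\<close>, \<open>(2,0)\<close>,
  \<open>(1,1)\<close> and \<open>(1,0)\<close>; they give the five structure equations, and \<open>r = 3 - (p + q)\<close>.
  The matrix identity \<open>\<epsilon> M = A\<^sup>T D cnj(A)\<close> with \<open>A\<close> invertible, \<open>D\<close> diagonal with these entries and
  \<open>\<epsilon>\<close> a sign (\<open>hermitian_congruent_signature\<close>) contains all the linear algebra.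
\<close>

section \<open>The sesquilinear form of a complex matrix\<close>

definition hform :: "complex^'n^'n \<Rightarrow> complex^'n \<Rightarrow> complex^'n \<Rightarrow> complex" where
  "hform M x y = (\<Sum>j\<in>UNIV. \<Sum>k\<in>UNIV. M $ j $ k * x $ j * cnj (y $ k))"

lemma hform_add_left: "hform M (x + x') y = hform M x y + hform M x' y"
  by (simp add: hform_def algebra_simps sum.distrib)

lemma hform_scale_left: "hform M (c *s x) y = c * hform M x y"
  by (simp add: hform_def sum_distrib_left mult_ac)

lemma hform_add_right: "hform M x (y + y') = hform M x y + hform M x y'"
  by (simp add: hform_def algebra_simps sum.distrib)

lemma hform_scale_right: "hform M x (c *s y) = cnj c * hform M x y"
  by (simp add: hform_def sum_distrib_left mult_ac)

lemma hform_zero_left [simp]: "hform M 0 y = 0"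
  by (simp add: hform_def)

lemma hform_zero_right [simp]: "hform M x 0 = 0"
  by (simp add: hform_def)

lemma hform_sum_left: "hform M (sum f A) y = (\<Sum>a\<in>A. hform M (f a) y)"
  by (induction A rule: infinite_finite_induct) (simp_all add: hform_add_left)

lemma hform_sum_right: "hform M x (sum f A) = (\<Sum>a\<in>A. hform M x (f a))"
  by (induction A rule: infinite_finite_induct) (simp_all add: hform_add_right)

lemma hform_axis: "hform M (axis j 1) (axis k 1) = M $ j $ k"
proof -
  have "hform M (axis j 1) (axis k 1) =
      (\<Sum>j'\<in>UNIV. \<Sum>k'\<in>UNIV. if k' = k then if j' = j then M $ j' $ k' else 0 else 0)"
    unfolding hform_def axis_def by (intro sum.cong refl) auto
  then show ?thesis by simp
qed

lemma hform_commute: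
  assumes "hermitian M"
  shows "hform M y x = cnj (hform M x y)"
proof -
  have "cnj (M $ j $ k) = M $ k $ j" for j k
    using assms unfolding hermitian_def by (rule_tac sym) blast
  then have "cnj (hform M x y) = (\<Sum>j\<in>UNIV. \<Sum>k\<in>UNIV. M $ k $ j * y $ k * cnj (x $ j))"
    by (simp add: hform_def mult_ac)
  also have "\<dots> = hform M y x"
    unfolding hform_def by (rule sum.swap)
  finally show ?thesis ..
qed

text \<open>
  Expanding the values at \<open>x + y\<close> and \<open>x + \<i> y\<close> gives \<open>H(x, y) + H(y, x) = 0\<close> and
  \<open>H(x, y) - H(y, x) = 0\<close>. Over the complex numbers both hold for every square matrix.
\<close>

lemma hform_polarization:
  assumes "vec.subspace S" and "\<And>v. v \<in> S \<Longrightarrow> hform M v v = 0"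
    and "x \<in> S" "y \<in> S"
  shows "hform M x y = 0"
proof -
  have "x + y \<in> S" "x + \<i> *s y \<in> S"
    using assms by (auto intro: vec.subspace_add vec.subspace_scale)
  then have "hform M (x + y) (x + y) = 0" "hform M (x + \<i> *s y) (x + \<i> *s y) = 0"
    "hform M x x = 0" "hform M y y = 0"
    using assms by auto
  then have "hform M x y + hform M y x = 0" "\<i> * (hform M y x - hform M x y) = 0"
    by (simp_all add: hform_add_left hform_add_right hform_scale_left hform_scale_right algebra_simps)
  then show ?thesis by simp
qed

section \<open>Orthogonal bases of Hermitian forms\<close>

text \<open>
  A Hermitian form is real on the diagonal, so a real rescaling normalizes any nonzero value up to
  its sign, which no rescaling can change.
\<close>

lemma hermitian_unit_vector:
  assumes "hermitian M" "vec.subspace S" "v \<in> S" "hform M v v \<noteq> 0"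
  obtains u where "u \<in> S" "hform M u u \<in> {1, -1}"
proof -
  have "cnj (hform M v v) = hform M v v"
    by (rule hform_commute[OF assms(1), symmetric])
  then have "hform M v v \<in> \<real>"
    by (simp only: Reals_cnj_iff)
  then obtain t where t: "hform M v v = complex_of_real t"
    by (rule Reals_cases)
  define c where "c = complex_of_real (1 / sqrt \<bar>t\<bar>)"
  have "t \<noteq> 0" using assms(4) t by auto
  have "hform M (c *s v) (c *s v) = complex_of_real (t / (sqrt \<bar>t\<bar> * sqrt \<bar>t\<bar>))"
    by (simp add: hform_scale_left hform_scale_right t c_def del: real_sqrt_mult_self
        flip: of_real_mult)
  also have "t / (sqrt \<bar>t\<bar> * sqrt \<bar>t\<bar>) = sgn t"
    using \<open>t \<noteq> 0\<close> by (simp add: sgn_if)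
  finally have "hform M (c *s v) (c *s v) = complex_of_real (sgn t)" .
  then have "hform M (c *s v) (c *s v) \<in> {1, -1}"
    using \<open>t \<noteq> 0\<close> by (auto simp: sgn_if)
  then show thesis
    by (rule that[rotated]) (rule vec.subspace_scale[OF assms(2,3)])
qed

text \<open>
  Gram--Schmidt for a form that may be indefinite or degenerate, by induction on the dimension. If
  the form has a nonzero value on \<open>S\<close>, split off a vector \<open>v\<close> with value \<open>1\<close> or \<open>-1\<close>; its orthogonal
  complement in \<open>S\<close> is a proper subspace, and it is complementary to \<open>v\<close> because the value at \<open>v\<close>
  can be divided by. Otherwise the form vanishes identically on \<open>S\<close> by polarization, and any basis
  will do. A subspace \<open>S\<close> in place of the whole space makes the induction possible.
\<close>

lemma hermitian_orthogonal_basis: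
  fixes M :: "complex^'n^'n"
  assumes "hermitian M" "vec.subspace S"
  shows "\<exists>B. vec.independent B \<and> vec.span B = S \<and>
    (\<forall>x\<in>B. \<forall>y\<in>B. x \<noteq> y \<longrightarrow> hform M x y = 0) \<and> (\<forall>x\<in>B. hform M x x \<in> {0, 1, -1})"
  using assms(2)
proof (induction "vec.dim S" arbitrary: S rule: less_induct)
  case less
  show ?case
  proof (cases "\<forall>v\<in>S. hform M v v = 0")
    case True
    obtain B where "B \<subseteq> S" "vec.independent B" "S \<subseteq> vec.span B" "card B = vec.dim S"
      by (rule vec.basis_exists)
    moreover from this have "vec.span B = S"
      using less.prems vec.span_minimal by blast
    moreover have "hform M x y = 0" if "x \<in> S" "y \<in> S" for x y
      by (rule hform_polarization[OF less.prems]) (use True that in auto)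
    ultimately show ?thesis
      by (intro exI[of _ B]) auto
  next
    case False
    then obtain v where v: "v \<in> S" "hform M v v \<in> {1, -1}"
      using hermitian_unit_vector[OF assms(1) less.prems] by blast
    define S' where "S' = {x \<in> S. hform M x v = 0}"
    have sub: "vec.subspace S'"
      using less.prems unfolding S'_def vec.subspace_def
      by (auto simp: hform_add_left hform_scale_left)
    have "v \<notin> S'"
      using v by (auto simp: S'_def)
    then have "S' \<subset> S"
      using v by (auto simp: S'_def)
    then have "vec.dim S' < vec.dim S"
      using sub less.prems
      by (intro vec.dim_psubset) (simp add: vec.span_eq_iff[THEN iffD2])
    obtain B where B: "vec.independent B" "vec.span B = S'"
      and orth: "\<And>x y. x \<in> B \<Longrightarrow> y \<in> B \<Longrightarrow> x \<noteq> y \<Longrightarrow> hform M x y = 0"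
      and val: "\<And>x. x \<in> B \<Longrightarrow> hform M x x \<in> {0, 1, -1}"
      using less.hyps[OF \<open>vec.dim S' < vec.dim S\<close> sub] by blast
    have v_orth: "hform M x v = 0" "hform M v x = 0" if "x \<in> B" for x
    proof -
      show "hform M x v = 0"
        using that B(2) vec.span_base by (auto simp: S'_def)
      then show "hform M v x = 0"
        using hform_commute[OF assms(1), of v x] by simp
    qed
    have "vec.independent (insert v B)"
      using B \<open>v \<notin> S'\<close> by (simp add: vec.independent_insertI)
    moreover have "vec.span (insert v B) = S"
    proof
      have "B \<subseteq> S"
        using B(2) vec.span_superset by (auto simp: S'_def)
      then show "vec.span (insert v B) \<subseteq> S"
        using v less.prems by (intro vec.span_minimal) auto
      show "S \<subseteq> vec.span (insert v B)"
      proof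
        fix x assume "x \<in> S"
        \<comment> \<open>\<open>c *s v\<close> is the orthogonal projection of \<open>x\<close> to the line of \<open>v\<close>.\<close>
        define c where "c = hform M x v / hform M v v"
        have "hform M (x - c *s v) v = 0"
          using v hform_add_left[of M "x - c *s v" "c *s v" v]
          by (auto simp: hform_scale_left c_def)
        then have "x - c *s v \<in> vec.span B"
          using \<open>x \<in> S\<close> v less.prems B(2)
          by (auto simp: S'_def intro: vec.subspace_diff vec.subspace_scale)
        then show "x \<in> vec.span (insert v B)"
          unfolding vec.span_insert by blast
      qed
    qed
    ultimately show ?thesis
      using orth val v v_orth by (intro exI[of _ "insert v B"]) auto
  qed
qed

text \<open>
  The rows of \<open>M\<close> span the range of \<open>T = M\<^sup>T\<close>, and \<open>H(x, y)\<close> is the pairing of \<open>T x\<close> with \<open>cnj y\<close>.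
  Hence \<open>T\<close> kills exactly the left radical of the form. A basis vector with value \<open>0\<close> is orthogonal
  to the whole basis and lies in the radical; on the span of the others \<open>T\<close> is injective, since
  pairing with such a basis vector recovers the coefficient at it.
\<close>

lemma rank_eq_card_nonisotropic:
  fixes M :: "complex^'n^'n"
  assumes ind: "vec.independent B" and span: "vec.span B = UNIV"
    and orth: "\<And>x y. x \<in> B \<Longrightarrow> y \<in> B \<Longrightarrow> x \<noteq> y \<Longrightarrow> hform M x y = 0"
  shows "rank M = card {b \<in> B. hform M b b \<noteq> 0}"
proof -
  define T where "T = (\<lambda>x. transpose M *v x)"
  define C where "C = {b \<in> B. hform M b b \<noteq> 0}"
  have lin: "Vector_Spaces.linear (*s) (*s) T"
    unfolding T_def by simp
  have hform_T: "hform M x y = (\<Sum>k\<in>UNIV. T x $ k * cnj (y $ k))" for x y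
    unfolding hform_def T_def
    by (subst sum.swap) (simp add: matrix_vector_mult_def transpose_def sum_distrib_right)
  have fin: "finite C"
    using vec.finiteI_independent[OF ind] by (simp add: C_def)
  have indC: "vec.independent C"
    using vec.independent_mono[OF ind, of C] by (simp add: C_def)
  have T_axis: "T (axis i 1) = row i M" for i
    by (simp add: T_def matrix_vector_mult_def transpose_def row_def axis_def vec_eq_iff
        if_distrib cong: if_cong del: transpose_matrix_vector)
  then have "rows M = T ` range (\<lambda>i. axis i 1)"
    by (simp add: rows_def image_image full_SetCompr_eq)
  then have "vec.span (rows M) = T ` vec.span (range (\<lambda>i. axis i 1))"
    using vec.linear_span_image[OF lin] by simp
  also have "vec.span (range (\<lambda>i. axis i (1::complex))) = (UNIV :: (complex^'n) set)"
    using span_cart_basis by (simp add: cart_basis_def full_SetCompr_eq)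
  also have "T ` UNIV = vec.span (T ` B)"
    using vec.linear_span_image[OF lin] span by simp
  also have "\<dots> = vec.span (T ` C)"
  proof -
    have "T b = 0" if "b \<in> B - C" for b
    proof -
      have "hform M b y = 0" for y
      proof -
        have "y \<in> vec.span B" using span by simp
        then show ?thesis
        proof (induction rule: vec.span_induct_alt)
          case base
          then show ?case by simp
        next
          case (step c x y)
          have "hform M b x = 0"
            using that step orth by (cases "b = x") (auto simp: C_def)
          then show ?case
            using step by (simp add: hform_add_right hform_scale_right)
        qed
      qed
      then have "T b $ k = 0" for k
        using hform_T[of b "axis k 1"] by (simp add: axis_def if_distrib if_distribR cong: if_cong)
      then show ?thesis
        by (simp add: vec_eq_iff)
    qed
    then have "T ` C \<subseteq> T ` B" "T ` B \<subseteq> insert 0 (T ` C)"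
      by (auto simp: C_def)
    then show ?thesis
      by (metis vec.span_insert_0 vec.span_mono subset_antisym)
  qed
  finally have "rank M = vec.dim (T ` C)"
    unfolding row_rank_def_gen by (metis vec.dim_span)
  also have "\<dots> = vec.dim C"
  proof (rule vec.dim_image_eq[OF lin])
    have "x = 0" if x: "x \<in> vec.span C" "T x = 0" for x
    proof -
      obtain u where u: "x = (\<Sum>b\<in>C. u b *s b)"
        using x(1) vec.span_finite[OF fin] by auto
      have "u b = 0" if "b \<in> C" for b
      proof -
        have "0 = hform M x b"
          using \<open>T x = 0\<close> by (simp add: hform_T)
        also have "\<dots> = (\<Sum>b'\<in>C. u b' * hform M b' b)"
          by (simp add: u hform_sum_left hform_scale_left)
        also have "\<dots> = (\<Sum>b'\<in>C. if b' = b then u b * hform M b b else 0)"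
          using that orth by (intro sum.cong) (auto simp: C_def)
        also have "\<dots> = u b * hform M b b"
          using fin that by simp
        finally show ?thesis
          using that by (simp add: C_def)
      qed
      then show "x = 0"
        by (simp add: u)
    qed
    then show "inj_on T (vec.span C)"
      using vec.linear_inj_on_iff_eq_0[OF lin vec.subspace_span] by blast
  qed
  also have "\<dots> = card C"
    by (rule vec.dim_eq_card_independent[OF indC])
  finally show ?thesis
    by (simp add: C_def)
qed

section \<open>Congruence to a signature matrix\<close>

text \<open>
  The \<open>i\<close>-th diagonal entry, counted from \<open>1\<close>, of the diagonal matrix with \<open>p\<close> ones followed by
  \<open>q\<close> minus ones and then zeros.
\<close>

definition signature_entry :: "nat \<Rightarrow> nat \<Rightarrow> nat \<Rightarrow> complex" where
  "signature_entry p q i = (if i \<le> p then 1 else if i \<le> p + q then -1 else 0)"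

lemma enumerate_three_blocks:
  assumes "finite P" "finite N" "finite Z" "P \<inter> N = {}" "P \<inter> Z = {}" "N \<inter> Z = {}"
  obtains b where "bij_betw b {1..card P + card N + card Z} (P \<union> N \<union> Z)"
    "\<And>i. i \<in> {1..card P} \<Longrightarrow> b i \<in> P"
    "\<And>i. i \<in> {card P<..card P + card N} \<Longrightarrow> b i \<in> N"
    "\<And>i. i \<in> {card P + card N<..card P + card N + card Z} \<Longrightarrow> b i \<in> Z"
proof -
  obtain xs ys zs where l: "set xs = P" "distinct xs" "set ys = N" "distinct ys"
    "set zs = Z" "distinct zs"
    using assms(1-3) finite_distinct_list by metis
  define ws where "ws = xs @ ys @ zs"
  have len: "length xs = card P" "length ys = card N" "length zs = card Z"
    using l by (auto simp flip: distinct_card)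
  have lw: "length ws = card P + card N + card Z"
    by (simp add: ws_def len)
  have "distinct ws" "set ws = P \<union> N \<union> Z"
    using l assms by (auto simp: ws_def)
  then have "bij_betw ((!) ws) {..<length ws} (P \<union> N \<union> Z)"
    by (intro bij_betw_nth) auto
  moreover have "bij_betw (\<lambda>i. i - 1) {1..length ws} {..<length ws}"
    by (rule bij_betw_byWitness[where f' = Suc]) auto
  ultimately have "bij_betw ((!) ws \<circ> (\<lambda>i. i - 1)) {1..length ws} (P \<union> N \<union> Z)"
    by (rule bij_betw_trans[rotated])
  moreover have "ws ! (i - 1) \<in> P" if "i \<in> {1..card P}" for i
    using that l(1) len nth_mem[of "i - 1" xs] by (auto simp: ws_def nth_append)
  moreover have "ws ! (i - 1) \<in> N" if "i \<in> {card P<..card P + card N}" for i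
    using that l(3) len nth_mem[of "i - 1 - card P" ys] by (auto simp: ws_def nth_append)
  moreover have "ws ! (i - 1) \<in> Z"
    if "i \<in> {card P + card N<..card P + card N + card Z}" for i
    using that l(5) len nth_mem[of "i - 1 - card P - card N" zs] by (auto simp: ws_def nth_append)
  ultimately show thesis
    using that[of "(!) ws \<circ> (\<lambda>i. i - 1)"] lw by simp
qed

text \<open>
  Enumerate an orthogonal basis as \<open>b\<^sub>1, \<dots>, b\<^sub>n\<close>, with the values \<open>\<epsilon>\<close> first, then \<open>-\<epsilon>\<close>, then \<open>0\<close>.
  Row \<open>i\<close> of \<open>A\<close> is the \<open>i\<close>-th coordinate functional of this basis and row \<open>i\<close> of \<open>B\<close> is the vector
  \<open>b\<^sub>i\<close>, so \<open>B\<^sup>T\<close> is inverse to \<open>A\<close>. Expanding the standard basis in the \<open>b\<^sub>i\<close> expresses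
  \<open>M\<^sub>j\<^sub>k = H(e\<^sub>j, e\<^sub>k)\<close> through the diagonal Gram matrix. The sign \<open>\<epsilon>\<close> is chosen as the one that
  occurs more often, which is what gives \<open>q \<le> p\<close>.
\<close>

lemma hermitian_congruent_signature:
  fixes M :: "complex^'n^'n"
  assumes "hermitian M"
  obtains \<epsilon> :: complex and p q and A B :: "nat \<Rightarrow> 'n \<Rightarrow> complex" where
    "\<epsilon> \<in> {1, -1}" "q \<le> p" "p + q = rank M"
    "\<And>j k. \<epsilon> * M $ j $ k = (\<Sum>i\<in>{1..CARD('n)}. signature_entry p q i * A i j * cnj (A i k))"
    "\<And>j k. (\<Sum>i\<in>{1..CARD('n)}. B i j * A i k) = (if j = k then 1 else 0)"
proof -
  obtain S where S: "vec.independent S" "vec.span S = UNIV"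
    and orth: "\<And>x y. x \<in> S \<Longrightarrow> y \<in> S \<Longrightarrow> x \<noteq> y \<Longrightarrow> hform M x y = 0"
    and val: "\<And>x. x \<in> S \<Longrightarrow> hform M x x \<in> {0, 1, -1}"
    using hermitian_orthogonal_basis[OF assms vec.subspace_UNIV] by metis
  define V where "V = (\<lambda>c. {x \<in> S. hform M x x = c})"
  obtain \<epsilon> :: complex where \<epsilon>: "\<epsilon> \<in> {1, -1}" "card (V (-\<epsilon>)) \<le> card (V \<epsilon>)"
  proof (cases "card (V (-1)) \<le> card (V 1)")
    case True
    then show thesis using that[of 1] by simp
  next
    case False
    then show thesis using that[of "-1"] by simp
  qed
  have finS: "finite S"
    using vec.finiteI_independent S(1) by blast
  then have fin: "finite (V c)" for c
    by (simp add: V_def)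
  have disj: "V \<epsilon> \<inter> V (-\<epsilon>) = {}" "V \<epsilon> \<inter> V 0 = {}" "V (-\<epsilon>) \<inter> V 0 = {}"
    using \<epsilon>(1) by (auto simp: V_def)
  have val_\<epsilon>: "hform M x x = 0 \<or> hform M x x = \<epsilon> \<or> hform M x x = -\<epsilon>" if "x \<in> S" for x
    using val[OF that] \<epsilon>(1) by auto
  then have un: "V \<epsilon> \<union> V (-\<epsilon>) \<union> V 0 = S"
    by (auto simp: V_def)
  define p q z where pqz: "p = card (V \<epsilon>)" "q = card (V (-\<epsilon>))" "z = card (V 0)"
  have "card S = CARD('n)"
    using vec.dim_span_eq_card_independent[OF S(1)] unfolding S(2) vec_dim_card by simp
  moreover have "card S = p + q + z"
  proof -
    have "card S = card (V \<epsilon> \<union> V (-\<epsilon>) \<union> V 0)"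
      by (simp only: un)
    also have "\<dots> = card (V \<epsilon> \<union> V (-\<epsilon>)) + card (V 0)"
      using fin disj by (intro card_Un_disjoint) auto
    also have "card (V \<epsilon> \<union> V (-\<epsilon>)) = p + q"
      using fin disj unfolding pqz by (intro card_Un_disjoint) auto
    finally show ?thesis by (simp add: pqz)
  qed
  ultimately have n: "p + q + z = CARD('n)" by simp
  have "{b \<in> S. hform M b b \<noteq> 0} = V \<epsilon> \<union> V (-\<epsilon>)"
    using \<epsilon>(1) val_\<epsilon> by (auto simp: V_def)
  then have rank: "p + q = rank M"
    using rank_eq_card_nonisotropic[OF S orth] fin disj
    by (simp add: card_Un_disjoint pqz)
  obtain b where b: "bij_betw b {1..CARD('n)} S"
    "\<And>i. i \<in> {1..p} \<Longrightarrow> b i \<in> V \<epsilon>"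
    "\<And>i. i \<in> {p<..p + q} \<Longrightarrow> b i \<in> V (-\<epsilon>)"
    "\<And>i. i \<in> {p + q<..CARD('n)} \<Longrightarrow> b i \<in> V 0"
    using enumerate_three_blocks[OF fin fin fin disj]
    unfolding un n[symmetric] pqz by metis
  have bS: "b i \<in> S" if "i \<in> {1..CARD('n)}" for i
    using b(1) that bij_betwE by blast
  have gram: "hform M (b i) (b l) = (if i = l then \<epsilon> * signature_entry p q i else 0)"
    if "i \<in> {1..CARD('n)}" "l \<in> {1..CARD('n)}" for i l
  proof (cases "i = l")
    case True
    have "hform M (b i) (b i) = \<epsilon> * signature_entry p q i"
      using b(2-4)[of i] that(1) by (auto simp: V_def signature_entry_def not_le)
    then show ?thesis using True by simp
  next
    case False
    then have "b i \<noteq> b l"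
      using inj_onD[OF bij_betw_imp_inj_on[OF b(1)] _ that] by blast
    then have "hform M (b i) (b l) = 0"
      by (rule orth[OF bS[OF that(1)] bS[OF that(2)]])
    then show ?thesis using False by simp
  qed
  define A where "A = (\<lambda>i j. vec.representation S (axis j 1) (b i))"
  define B where "B = (\<lambda>i j. b i $ j)"
  have expand: "axis j 1 = (\<Sum>i\<in>{1..CARD('n)}. A i j *s b i)" for j
  proof -
    have "axis j 1 = (\<Sum>v\<in>S. vec.representation S (axis j 1) v *s v)"
      using vec.sum_representation_eq[OF S(1) _ finS subset_refl, of "axis j 1"] S(2) by simp
    also have "\<dots> = (\<Sum>i\<in>{1..CARD('n)}. A i j *s b i)"
      unfolding A_def by (rule sum.reindex_bij_betw[OF b(1), symmetric])
    finally show ?thesis .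
  qed
  have "M $ j $ k = (\<Sum>i\<in>{1..CARD('n)}. \<epsilon> * signature_entry p q i * A i j * cnj (A i k))" for j k
  proof -
    have "M $ j $ k = hform M (axis j 1) (axis k 1)"
      by (simp add: hform_axis)
    also have "\<dots> = (\<Sum>i\<in>{1..CARD('n)}. \<Sum>l\<in>{1..CARD('n)}. A i j * (cnj (A l k) * hform M (b i) (b l)))"
      by (subst (1 2) expand)
        (simp only: hform_sum_left hform_scale_left,
         simp only: hform_sum_right hform_scale_right sum_distrib_left)
    also have "\<dots> = (\<Sum>i\<in>{1..CARD('n)}. \<Sum>l\<in>{1..CARD('n)}.
        if i = l then \<epsilon> * signature_entry p q i * A i j * cnj (A i k) else 0)"
      by (intro sum.cong refl) (simp add: gram)
    also have "\<dots> = (\<Sum>i\<in>{1..CARD('n)}. \<epsilon> * signature_entry p q i * A i j * cnj (A i k))"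
      by (intro sum.cong refl) simp
    finally show ?thesis .
  qed
  moreover have "\<epsilon> * \<epsilon> = 1"
    using \<epsilon>(1) by auto
  ultimately have "\<epsilon> * M $ j $ k =
      (\<Sum>i\<in>{1..CARD('n)}. signature_entry p q i * A i j * cnj (A i k))" for j k
    by (simp add: sum_distrib_left mult.assoc[symmetric])
  moreover have "(\<Sum>i\<in>{1..CARD('n)}. B i j * A i k) = (if j = k then 1 else 0)" for j k
  proof -
    have "(\<Sum>i\<in>{1..CARD('n)}. B i j * A i k) = (\<Sum>i\<in>{1..CARD('n)}. A i k *s b i) $ j"
      by (simp add: B_def mult.commute)
    also have "\<dots> = axis k 1 $ j"
      by (simp only: expand[symmetric])
    finally show ?thesis
      by (simp add: axis_def)
  qed
  ultimately show thesis
    using that[of \<epsilon> q p A B] \<epsilon> rank n pqz by simp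
qed

text \<open>
  The identity \<open>\<epsilon> M = A\<^sup>T D cnj(A)\<close> read as a diagonal expression of the form in the coordinates
  given by the rows of \<open>A\<close>; these coordinates become the new (1,0)-forms.
\<close>

lemma hform_congruent:
  fixes M :: "complex^'n^'n"
  assumes "\<And>j k. \<epsilon> * M $ j $ k = (\<Sum>i\<in>I. s i * A i j * cnj (A i k))"
  shows "\<epsilon> * hform M u v =
    (\<Sum>i\<in>I. s i * (\<Sum>j\<in>UNIV. A i j * u $ j) * cnj (\<Sum>k\<in>UNIV. A i k * v $ k))"
proof -
  have "\<epsilon> * hform M u v = (\<Sum>j\<in>UNIV. \<Sum>k\<in>UNIV. \<epsilon> * M $ j $ k * (u $ j * cnj (v $ k)))"
    by (simp add: hform_def sum_distrib_left mult.assoc)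
  also have "\<dots> = (\<Sum>j\<in>UNIV. \<Sum>k\<in>UNIV. \<Sum>i\<in>I. s i * (A i j * u $ j) * cnj (A i k * v $ k))"
    unfolding assms sum_distrib_right by (intro sum.cong refl) simp
  also have "\<dots> = (\<Sum>i\<in>I. \<Sum>j\<in>UNIV. \<Sum>k\<in>UNIV. s i * (A i j * u $ j) * cnj (A i k * v $ k))"
    by (simp only: sum.swap[of _ I])
  also have "\<dots> = (\<Sum>i\<in>I. s i * (\<Sum>j\<in>UNIV. A i j * u $ j) * cnj (\<Sum>k\<in>UNIV. A i k * v $ k))"
    unfolding cnj_sum sum_distrib_left sum_distrib_right by (intro sum.cong refl sum.swap)
  finally show ?thesis .
qed

section \<open>Changing the basis of (1,0)-forms\<close>

text \<open>
  A family of \<open>n\<close> forms that spans an \<open>n\<close>-dimensional space is a basis. The space of all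
  complex-valued functions may be infinite-dimensional, so this is obtained by extracting from the family
  a basis of its span: it has \<open>n\<close> elements and therefore uses up the whole family without
  repetition.
\<close>

lemma basis10_change:
  assumes "basis10 J n \<omega>"
    and \<sigma>: "\<And>i. i \<in> {1..n} \<Longrightarrow> \<sigma> i \<in> form.span (\<omega> ` {1..n})"
    and \<omega>: "\<And>i. i \<in> {1..n} \<Longrightarrow> \<omega> i \<in> form.span (\<sigma> ` {1..n})"
  shows "basis10 J n \<sigma>"
proof -
  have "form.span (\<sigma> ` {1..n}) = form.span (\<omega> ` {1..n})"
    using \<sigma> \<omega> by (subst form.span_eq) auto
  then have span: "form.span (\<sigma> ` {1..n}) = forms10 J"
    using assms(1) by (simp add: basis10_def)
  have "form.dim (forms10 J) = form.dim (\<omega> ` {1..n})"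
    using assms(1) unfolding basis10_def by (metis form.dim_span)
  also have "\<dots> = card (\<omega> ` {1..n})"
    using assms(1) unfolding basis10_def by (intro form.dim_eq_card_independent) blast
  also have "\<dots> = n"
    using assms(1) by (simp add: basis10_def card_image)
  finally have dim: "form.dim (\<sigma> ` {1..n}) = n"
    by (simp only: span[symmetric] form.dim_span)
  obtain C where C: "C \<subseteq> \<sigma> ` {1..n}" "form.independent C"
    "\<sigma> ` {1..n} \<subseteq> form.span C" "card C = form.dim (\<sigma> ` {1..n})"
    by (rule form.basis_exists)
  have "card (\<sigma> ` {1..n}) \<le> n"
    using card_image_le[of "{1..n}" \<sigma>] by simp
  then have eq: "C = \<sigma> ` {1..n}"
    using C(1,4) dim by (intro card_seteq) auto
  then have "inj_on \<sigma> {1..n}"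
    using C(4) dim by (intro eq_card_imp_inj_on) auto
  then show ?thesis
    using C(2) eq span by (simp add: basis10_def)
qed

section \<open>The structure equations\<close>

lemma sum_upto_3: "(\<Sum>i\<in>{1..3::nat}. f i) = f 1 + f 2 + (f 3 :: 'b::comm_monoid_add)"
  by (simp add: eval_nat_numeral add.assoc)

theorem theorem4p19:
  fixes br :: "'a::real_vector \<Rightarrow> 'a \<Rightarrow> 'a"
    and J :: "'a \<Rightarrow> 'a"
    and \<omega> :: "nat \<Rightarrow> 'a \<Rightarrow> complex"
    and M :: "complex^3^3"
    and r :: nat
  assumes "dim (UNIV :: 'a set) = 8"
    and "lie_bracket br"
    and "nilpotent_lie br"
    and "one_abelian br J"
    and "JM_basis br J \<omega> M"
    and "hermitian M"
    and "r \<le> 3" and "rank M = 3 - r"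
  shows "\<exists>\<sigma>. basis10 J 4 \<sigma> \<and>
      ce_d br (\<sigma> 1) = 0 \<and> ce_d br (\<sigma> 2) = 0 \<and> ce_d br (\<sigma> 3) = 0 \<and>
      ((r = 0 \<and> ce_d br (\<sigma> 4) = wedge_conj \<sigma> 1 1 + wedge_conj \<sigma> 2 2 + wedge_conj \<sigma> 3 3) \<or>
       (r = 0 \<and> ce_d br (\<sigma> 4) = wedge_conj \<sigma> 1 1 + wedge_conj \<sigma> 2 2 - wedge_conj \<sigma> 3 3) \<or>
       (r = 1 \<and> ce_d br (\<sigma> 4) = wedge_conj \<sigma> 1 1 + wedge_conj \<sigma> 2 2) \<or>
       (r = 1 \<and> ce_d br (\<sigma> 4) = wedge_conj \<sigma> 1 1 - wedge_conj \<sigma> 2 2) \<or>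
       (r = 2 \<and> ce_d br (\<sigma> 4) = wedge_conj \<sigma> 1 1))"
proof -
  obtain \<epsilon> :: complex and p q and A B :: "nat \<Rightarrow> 3 \<Rightarrow> complex" where
    \<epsilon>: "\<epsilon> \<in> {1, -1}" and pq: "q \<le> p" "p + q = rank M"
    and M': "\<And>j k. \<epsilon> * M $ j $ k =
      (\<Sum>i\<in>{1..CARD(3)}. signature_entry p q i * A i j * cnj (A i k))"
    and BA': "\<And>j k. (\<Sum>i\<in>{1..CARD(3)}. B i j * A i k) = (if j = k then 1 else 0)"
    by (rule hermitian_congruent_signature[OF \<open>hermitian M\<close>]) (rule that)
  have "CARD(3) = 3"
    by simp
  note M = M'[unfolded this] and BA = BA'[unfolded this]
  have basis: "basis10 J 4 \<omega>" and "M \<noteq> 0"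
    and closed: "\<And>i. i \<in> {1..3} \<Longrightarrow> ce_d br (\<omega> i) = 0"
    and d4: "ce_d br (\<omega> 4) = (\<lambda>x y. \<Sum>j\<in>{1..3}. \<Sum>k\<in>{1..3}.
      M $ of_nat j $ of_nat k * wedge_conj \<omega> j k x y)"
    using \<open>JM_basis br J \<omega> M\<close> by (simp_all add: JM_basis_def)
  define \<sigma> where "\<sigma> = (\<lambda>i::nat. if i = 4 then form_scale \<epsilon> (\<omega> 4)
    else form_scale (A i 1) (\<omega> 1) + form_scale (A i 2) (\<omega> 2) + form_scale (A i 3) (\<omega> 3))"
  have \<sigma>123: "\<sigma> i = form_scale (A i 1) (\<omega> 1) + form_scale (A i 2) (\<omega> 2) + form_scale (A i 3) (\<omega> 3)"
    if "i \<in> {1..3}" for i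
    using that by (simp add: \<sigma>_def)
  have \<sigma>4: "\<sigma> 4 = form_scale \<epsilon> (\<omega> 4)"
    by (simp add: \<sigma>_def)
  \<comment> \<open>The inverse substitution: \<open>\<epsilon>\<close> is its own inverse, and \<open>B\<^sup>T\<close> inverts \<open>A\<close>.\<close>
  have \<omega>4: "\<omega> 4 = form_scale \<epsilon> (\<sigma> 4)"
    using \<epsilon> by (auto simp: \<sigma>4 form_scale_def)
  \<comment> \<open>The number \<open>m\<close> and the matrix index \<open>j\<close> are the same index in two types.\<close>
  have \<omega>_back: "\<omega> m = form_scale (B 1 j) (\<sigma> 1) + form_scale (B 2 j) (\<sigma> 2) + form_scale (B 3 j) (\<sigma> 3)"
    if "(m, j) \<in> {(1, 1), (2, 2), (3, 3)}" for m :: nat and j :: 3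
  proof
    fix x
    have "(\<Sum>i\<in>{1..3}. B i j * \<sigma> i x) =
        (\<Sum>i\<in>{1..3}. B i j * A i 1) * \<omega> 1 x + (\<Sum>i\<in>{1..3}. B i j * A i 2) * \<omega> 2 x +
        (\<Sum>i\<in>{1..3}. B i j * A i 3) * \<omega> 3 x"
      unfolding sum_upto_3 by (simp add: \<sigma>123 form_scale_def algebra_simps)
    also have "\<dots> = \<omega> m x"
      using that BA[of j] by auto
    finally show "\<omega> m x = (form_scale (B 1 j) (\<sigma> 1) + form_scale (B 2 j) (\<sigma> 2) + form_scale (B 3 j) (\<sigma> 3)) x"
      unfolding sum_upto_3 by (simp add: form_scale_def)
  qed
  have "basis10 J 4 \<sigma>"
  proof (rule basis10_change[OF basis])
    fix i :: nat assume i: "i \<in> {1..4}"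
    then have cases: "i = 4 \<or> i \<in> {1..3}" "i = 4 \<or> i = 1 \<or> i = 2 \<or> i = 3"
      by auto
    have base: "f k \<in> form.span (f ` {1..4})" if "k \<in> {1..4}" for f :: "nat \<Rightarrow> 'a \<Rightarrow> complex" and k
      using that by (intro form.span_base imageI)
    have comb: "form_scale a (f 1) + form_scale b (f 2) + form_scale c (f 3) \<in> form.span (f ` {1..4})"
      for a b c and f :: "nat \<Rightarrow> 'a \<Rightarrow> complex"
      by (intro form.span_add form.span_scale base) auto
    show "\<sigma> i \<in> form.span (\<omega> ` {1..4})"
    proof (cases "i = 4")
      case True
      then show ?thesis
        unfolding True \<sigma>4 by (intro form.span_scale base) auto
    next
      case False
      then have "i \<in> {1..3}"
        using cases by blast
      then show ?thesis
        unfolding \<sigma>123[OF \<open>i \<in> {1..3}\<close>] by (intro comb)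
    qed
    have "\<omega> 4 \<in> form.span (\<sigma> ` {1..4})"
      unfolding \<omega>4 by (intro form.span_scale base) auto
    moreover have "\<omega> 1 \<in> form.span (\<sigma> ` {1..4})"
      by (subst \<omega>_back[of 1 1]) (simp, rule comb)
    moreover have "\<omega> 2 \<in> form.span (\<sigma> ` {1..4})"
      by (subst \<omega>_back[of 2 2]) (simp, rule comb)
    moreover have "\<omega> 3 \<in> form.span (\<sigma> ` {1..4})"
      by (subst \<omega>_back[of 3 3]) (simp, rule comb)
    ultimately show "\<omega> i \<in> form.span (\<sigma> ` {1..4})"
      using cases(2) by metis
  qed
  moreover have "ce_d br (\<sigma> i) = 0" if "i \<in> {1..3}" for i
    using closed[of 1] closed[of 2] closed[of 3]
    by (simp add: \<sigma>123[OF that] ce_d_def form_scale_def fun_eq_iff)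
  moreover have "ce_d br (\<sigma> 4) x y =
      (\<Sum>i\<in>{1..3}. signature_entry p q i * wedge_conj \<sigma> i i x y)" for x y
  proof -
    \<comment> \<open>The (1,0)-forms enter the right-hand side only through this vector of values, and the wedge
      product antisymmetrizes the sesquilinear form of \<open>M\<close>.\<close>
    define X where "X = (\<lambda>x. vector [\<omega> 1 x, \<omega> 2 x, \<omega> 3 x] :: complex^3)"
    have \<sigma>X: "\<sigma> i x = (\<Sum>j\<in>UNIV. A i j * X x $ j)" if "i \<in> {1..3}" for i x
      using that by (simp add: \<sigma>123 sum_3 form_scale_def X_def)
    have "ce_d br (\<omega> 4) x y = hform M (X x) (X y) - hform M (X y) (X x)"
      unfolding d4 sum_upto_3
      by (simp add: hform_def sum_3 X_def wedge_conj_def wedge_def conj_form_def algebra_simps)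
    then have "ce_d br (\<sigma> 4) x y = \<epsilon> * hform M (X x) (X y) - \<epsilon> * hform M (X y) (X x)"
      by (simp add: \<sigma>4 ce_d_def form_scale_def algebra_simps)
    also have "\<dots> = (\<Sum>i\<in>{1..3}. signature_entry p q i * wedge_conj \<sigma> i i x y)"
      unfolding hform_congruent[OF M] sum_subtractf[symmetric]
      by (intro sum.cong) (simp_all add: \<sigma>X wedge_conj_def wedge_def conj_form_def algebra_simps
          del: sum_3 cnj_sum)
    finally show ?thesis .
  qed
  moreover have "p + q \<noteq> 0"
  proof
    assume "p + q = 0"
    then have "\<epsilon> * M $ j $ k = 0" for j k
      unfolding M by (intro sum.neutral) (simp add: signature_entry_def)
    then show False
      using \<open>M \<noteq> 0\<close> \<epsilon> by (auto simp: vec_eq_iff)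
  qed
  moreover have "(p = 3 \<and> q = 0 \<and> r = 0) \<or> (p = 2 \<and> q = 1 \<and> r = 0) \<or> (p = 2 \<and> q = 0 \<and> r = 1)
      \<or> (p = 1 \<and> q = 1 \<and> r = 1) \<or> (p = 1 \<and> q = 0 \<and> r = 2)"
    using pq \<open>rank M = 3 - r\<close> \<open>r \<le> 3\<close> \<open>p + q \<noteq> 0\<close> by presburger
  ultimately show ?thesis
    unfolding sum_upto_3
    by (intro exI[of _ \<sigma>]) (auto simp: fun_eq_iff signature_entry_def)
qed

end
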